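(* (Reversibility 1) Let $G\in\mathbb{GS}$ and let $A$ be a Left option of $G$ which is reversible through $B$, i.e. $B$ is a Right option of $A$ with $B\preccurlyeq G$. If $B^{\mathcal L}$ is a nonempty set of games (not an atom), then $G\sim\langle (G^{\mathcal L}\setminus\{A\})\cup B^{\mathcal L}\mid G^{\mathcal R}\rangle$.
   Context: A scoring game is written $G=\langle G^{\mathcal L}\mid G^{\mathcal R}\rangle$, where each of $G^{\mathcal L}$ (Left options) and $G^{\mathcal R}$ (Right options) is either a finite nonempty set of scoring games or an atom $\emptyset^{s}$, $s\in\mathbb R$ (the player to move on that side cannot move and the game ends with score $s$); game trees are finite. An atom occurring in $G$ is an atom of $G$ or of any follower of $G$. $G$ is guaranteed if for every follower $K$ of $G$: if $K^{\mathcal L}=\emptyset^\ell$ then $\ell\le s$ for every atom $\emptyset^s$ occurring in $K$, and if $K^{\mathcal R}=\emptyset^r$ then $s\le r$ for every atom $\emptyset^s$ occurring in $K$; $\mathbb{GS}$ is the class of guaranteed games. Disjunctive sum $G+H$: Left options are $G^L+H$ and $G+H^L$, except if both are left-atomic with atoms $\emptyset^{\ell_1},\emptyset^{\ell_2}$, then $(G+H)^{\mathcal L}=\emptyset^{\ell_1+\ell_2}$; Right symmetric. Stops: $Ls(G)=\ell$ if $G^{\mathcal L}=\emptyset^\ell$, otherwise $\max_{G^L}Rs(G^L)$; $Rs(G)=r$ if $G^{\mathcal R}=\emptyset^r$, otherwise $\min_{G^R}Ls(G^R)$. $G\succcurlyeq H$ iff $Ls(G+X)\ge Ls(H+X)$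 and $Rs(G+X)\ge Rs(H+X)$ for all $X\in\mathbb{GS}$; $B\preccurlyeq G$ means $G\succcurlyeq B$; $G\sim H$ iff $G\succcurlyeq H$ and $H\succcurlyeq G$. *)

theory Defs
  imports Complex_Main "HOL-Library.FSet"
begin

datatype game = Game (lside: side) (rside: side)
  and side = Atom real | Opts "game fset"

fun side_opts :: "side \<Rightarrow> game fset" where
  "side_opts (Atom s) = {||}"
| "side_opts (Opts S) = S"

abbreviation lopts :: "game \<Rightarrow> game fset" where
  "lopts G \<equiv> side_opts (lside G)"

abbreviation ropts :: "game \<Rightarrow> game fset" where
  "ropts G \<equiv> side_opts (rside G)"

lemma size_fset_member: "x |\<in>| S \<Longrightarrow> size x < size_fset size S"
  using member_le_sum[of x "fset S" "\<lambda>x. Suc (size x)"] by (simp add: size_fset_simps)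

lemma size_side_opts: "x |\<in>| side_opts s \<Longrightarrow> size x < size s"
  by (cases s) (auto dest: size_fset_member)

lemma size_lopts: "x |\<in>| lopts G \<Longrightarrow> size x < size G"
  and size_ropts: "x |\<in>| ropts G \<Longrightarrow> size x < size G"
  by (cases G; force dest: size_side_opts)+

text \<open>Every game is a follower of itself.\<close>

inductive follower :: "game \<Rightarrow> game \<Rightarrow> bool" where
  refl: "follower G G"
| left: "follower K H \<Longrightarrow> H |\<in>| lopts G \<Longrightarrow> follower K G"
| right: "follower K H \<Longrightarrow> H |\<in>| ropts G \<Longrightarrow> follower K G"

text \<open>The datatype also contains trees with empty option sets; these are not scoring games,
  since a player without a move must be assigned an atom.\<close>

definition scoring_game :: "game \<Rightarrow> bool" where
  "scoring_game G \<longleftrightarrow>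
    (\<forall>K. follower K G \<longrightarrow> lside K \<noteq> Opts {||} \<and> rside K \<noteq> Opts {||})"

definition atoms :: "game \<Rightarrow> real set" where
  "atoms G = {s. \<exists>K. follower K G \<and> (lside K = Atom s \<or> rside K = Atom s)}"

definition GS :: "game set" where
  "GS = {G. scoring_game G \<and>
    (\<forall>K. follower K G \<longrightarrow>
      (\<forall>l. lside K = Atom l \<longrightarrow> (\<forall>s\<in>atoms K. l \<le> s)) \<and>
      (\<forall>r. rside K = Atom r \<longrightarrow> (\<forall>s\<in>atoms K. s \<le> r)))}"

function gsum :: "game \<Rightarrow> game \<Rightarrow> game" (infixl "\<oplus>" 65) where
  "G \<oplus> H = Game
    (case (lside G, lside H) of
      (Atom l1, Atom l2) \<Rightarrow> Atom (l1 + l2)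
    | _ \<Rightarrow> Opts ((\<lambda>G'. G' \<oplus> H) |`| lopts G |\<union>| (\<lambda>H'. G \<oplus> H') |`| lopts H))
    (case (rside G, rside H) of
      (Atom r1, Atom r2) \<Rightarrow> Atom (r1 + r2)
    | _ \<Rightarrow> Opts ((\<lambda>G'. G' \<oplus> H) |`| ropts G |\<union>| (\<lambda>H'. G \<oplus> H') |`| ropts H))"
  by auto
termination
  by (relation "measure (\<lambda>(G, H). size G + size H)") (auto dest: size_lopts size_ropts)

declare gsum.simps [simp del]

function Ls :: "game \<Rightarrow> real" and Rs :: "game \<Rightarrow> real" where
  "Ls G = (case lside G of Atom l \<Rightarrow> l | Opts S \<Rightarrow> Max (Rs ` fset S))"
| "Rs G = (case rside G of Atom r \<Rightarrow> r | Opts S \<Rightarrow> Min (Ls ` fset S))"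
  by pat_completeness auto
termination
  by (relation "measure (case_sum size size)")
    (auto, metis side_opts.simps(2) size_lopts, metis side_opts.simps(2) size_ropts)

declare Ls.simps [simp del] Rs.simps [simp del]

definition game_ge :: "game \<Rightarrow> game \<Rightarrow> bool" (infix "\<succeq>" 50) where
  "G \<succeq> H \<longleftrightarrow> (\<forall>X\<in>GS. Ls (G \<oplus> X) \<ge> Ls (H \<oplus> X) \<and> Rs (G \<oplus> X) \<ge> Rs (H \<oplus> X))"

abbreviation game_le :: "game \<Rightarrow> game \<Rightarrow> bool" (infix "\<preceq>" 50) where
  "G \<preceq> H \<equiv> H \<succeq> G"

definition game_equiv :: "game \<Rightarrow> game \<Rightarrow> bool" (infix "\<sim>" 50) where
  "G \<sim> H \<longleftrightarrow> G \<succeq> H \<and> H \<succeq> G"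

end

theory Submission
  imports Defs
begin

text \<open>By induction on the test game \<open>X\<close>, the stops of \<open>G \<oplus> X\<close> and \<open>H \<oplus> X\<close> agree, where \<open>H\<close> is the
  modified game. Right stops agree because both games have the same Right side. For Left stops, a
  Left move from \<open>H\<close> to some Left option of \<open>B\<close> gives at most \<open>Ls (B \<oplus> X) \<le> Ls (G \<oplus> X)\<close>. Conversely,
  the move from \<open>G\<close> to \<open>A\<close> gives at most \<open>Ls (B \<oplus> X)\<close>, since Right can answer \<open>B\<close>. As \<open>B\<close> is not
  left-atomic, this value is attained by a Left move: one in \<open>B\<close> is also available in \<open>H\<close>, and for one
  in \<open>X\<close> the comparison \<open>B \<preceq> G\<close> and the induction hypothesis apply.\<close>

lemma GS_lopts: "X \<in> GS \<Longrightarrow> Y |\<in>| lopts X \<Longrightarrow> Y \<in> GS"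
  unfolding GS_def scoring_game_def by (blast intro: follower.left)

lemma GS_ropts: "X \<in> GS \<Longrightarrow> Y |\<in>| ropts X \<Longrightarrow> Y \<in> GS"
  unfolding GS_def scoring_game_def by (blast intro: follower.right)

lemma Rs_le_Ls: "Z |\<in>| lopts Y \<Longrightarrow> Rs Z \<le> Ls Y"
  by (cases "lside Y") (auto simp: Ls.simps[of Y])

lemma Rs_le_Ls_ropts: "Z |\<in>| ropts Y \<Longrightarrow> Rs Y \<le> Ls Z"
  by (cases "rside Y") (auto simp: Rs.simps[of Y])

lemma Ls_attained:
  assumes "lopts Y \<noteq> {||}"
  obtains Z where "Z |\<in>| lopts Y" "Ls Y = Rs Z"
proof (cases "lside Y")
  case (Opts S)
  with assms have "Max (Rs ` fset S) \<in> Rs ` fset S"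
    by (intro Max_in) auto
  with Opts that show ?thesis by (auto simp: Ls.simps[of Y])
qed (use assms in simp)

lemma lopts_gsum:
  "lopts (G \<oplus> X) = (\<lambda>G'. G' \<oplus> X) |`| lopts G |\<union>| (\<lambda>X'. G \<oplus> X') |`| lopts X"
  by (subst gsum.simps) (auto split: side.splits)

lemma ropts_gsum:
  "ropts (G \<oplus> X) = (\<lambda>G'. G' \<oplus> X) |`| ropts G |\<union>| (\<lambda>X'. G \<oplus> X') |`| ropts X"
  by (subst gsum.simps) (auto split: side.splits)

text \<open>A Right move in the first component leads to the same games for \<open>G\<close> and
  \<open>H\<close>, and if no Right move exists the final score depends only on the Right
  sides.\<close>

lemma Rs_gsum_cong:
  assumes "rside G = rside H"
    and "\<And>X'. X' |\<in>| ropts X \<Longrightarrow> Ls (G \<oplus> X') = Ls (H \<oplus> X')"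
  shows "Rs (G \<oplus> X) = Rs (H \<oplus> X)"
proof -
  have "(\<lambda>X'. Ls (G \<oplus> X')) ` fset (ropts X) = (\<lambda>X'. Ls (H \<oplus> X')) ` fset (ropts X)"
    using assms(2) by (intro image_cong) auto
  then show ?thesis
    using assms(1)
    by (subst (1 2) Rs.simps, subst (1 2) gsum.simps)
      (auto split: side.splits simp: image_Un image_image)
qed

text \<open>A Left option of \<open>G\<close> keeps the sum from being left-atomic, so the left stop
  is attained by a move in one of the components.\<close>

lemma Ls_gsum_le:
  assumes "lopts G \<noteq> {||}"
    and "\<And>G'. G' |\<in>| lopts G \<Longrightarrow> Rs (G' \<oplus> X) \<le> c"
    and "\<And>X'. X' |\<in>| lopts X \<Longrightarrow> Rs (G \<oplus> X') \<le> c"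
  shows "Ls (G \<oplus> X) \<le> c"
proof -
  have "lopts (G \<oplus> X) \<noteq> {||}" using assms(1) by (auto simp: lopts_gsum)
  then obtain Z where "Z |\<in>| lopts (G \<oplus> X)" "Ls (G \<oplus> X) = Rs Z" by (rule Ls_attained)
  with assms(2,3) show ?thesis by (auto simp: lopts_gsum)
qed

theorem theorem30:
  fixes G A B :: game and GL AR BL :: "game fset"
  assumes "G \<in> GS"
    and "lside G = Opts GL" and "A |\<in>| GL"
    and "rside A = Opts AR" and "B |\<in>| AR"
    and "B \<preceq> G"
    and "lside B = Opts BL" and "BL \<noteq> {||}"
  shows "G \<sim> Game (Opts ((GL |-| {|A|}) |\<union>| BL)) (rside G)"
proof -
  define H where "H = Game (Opts ((GL |-| {|A|}) |\<union>| BL)) (rside G)"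
  have loptsG: "lopts G = GL" and loptsB: "lopts B = BL"
    and loptsH: "lopts H = (GL |-| {|A|}) |\<union>| BL"
    using assms by (simp_all add: H_def)
  have "Ls (G \<oplus> X) = Ls (H \<oplus> X) \<and> Rs (G \<oplus> X) = Rs (H \<oplus> X)" if "X \<in> GS" for X
    using that
  proof (induction X rule: measure_induct_rule[of size])
    case (less X)
    have IHl: "Rs (G \<oplus> X') = Rs (H \<oplus> X')" if "X' |\<in>| lopts X" for X'
      using less.IH[OF size_lopts[OF that] GS_lopts[OF less.prems that]] by simp
    have IHr: "Ls (G \<oplus> X') = Ls (H \<oplus> X')" if "X' |\<in>| ropts X" for X'
      using less.IH[OF size_ropts[OF that] GS_ropts[OF less.prems that]] by simp
    have right: "Rs (G \<oplus> X) = Rs (H \<oplus> X)"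
      using IHr by (intro Rs_gsum_cong) (simp_all add: H_def)
    have moveX: "Rs (K \<oplus> X') \<le> Ls (K \<oplus> X)" if "X' |\<in>| lopts X" for K X'
      using that by (intro Rs_le_Ls) (simp add: lopts_gsum)
    have moveK: "Rs (K' \<oplus> X) \<le> Ls (K \<oplus> X)" if "K' |\<in>| lopts K" for K K'
      using that by (intro Rs_le_Ls) (simp add: lopts_gsum)
    have BG: "Ls (B \<oplus> X) \<le> Ls (G \<oplus> X)"
      using \<open>B \<preceq> G\<close> less.prems by (simp add: game_ge_def)
    have BH: "Ls (B \<oplus> X) \<le> Ls (H \<oplus> X)"
    proof (rule Ls_gsum_le)
      show "lopts B \<noteq> {||}" using assms by simp
      show "Rs (B' \<oplus> X) \<le> Ls (H \<oplus> X)" if "B' |\<in>| lopts B" for B'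
        using that by (intro moveK) (simp add: loptsB loptsH)
      show "Rs (B \<oplus> X') \<le> Ls (H \<oplus> X)" if "X' |\<in>| lopts X" for X'
      proof -
        have "Rs (B \<oplus> X') \<le> Rs (G \<oplus> X')"
          using \<open>B \<preceq> G\<close> GS_lopts[OF less.prems that] by (simp add: game_ge_def)
        also have "\<dots> = Rs (H \<oplus> X')" using that by (rule IHl)
        also have "\<dots> \<le> Ls (H \<oplus> X)" using that by (rule moveX)
        finally show ?thesis .
      qed
    qed
    have "Rs (A \<oplus> X) \<le> Ls (B \<oplus> X)"
      using assms by (intro Rs_le_Ls_ropts) (simp add: ropts_gsum)
    with BH have AH: "Rs (A \<oplus> X) \<le> Ls (H \<oplus> X)" by simp
    have "Ls (G \<oplus> X) \<le> Ls (H \<oplus> X)"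
    proof (rule Ls_gsum_le)
      show "lopts G \<noteq> {||}" using assms by auto
      show "Rs (G' \<oplus> X) \<le> Ls (H \<oplus> X)" if "G' |\<in>| lopts G" for G'
        \<comment> \<open>\<open>A\<close> is the only Left option that \<open>H\<close> may lose;
          every other one is still a move from \<open>H\<close>.\<close>
        using AH moveK[of G' H] that by (cases "G' = A") (auto simp: loptsG loptsH)
      show "Rs (G \<oplus> X') \<le> Ls (H \<oplus> X)" if "X' |\<in>| lopts X" for X'
        using moveX[OF that, of H] IHl[OF that] by simp
    qed
    moreover have "Ls (H \<oplus> X) \<le> Ls (G \<oplus> X)"
    proof (rule Ls_gsum_le)
      \<comment> \<open>Even if \<open>A\<close> is the only Left option of \<open>G\<close>, those
        of \<open>B\<close> remain.\<close>
      show "lopts H \<noteq> {||}" using assms by (simp add: loptsH)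
      show "Rs (H' \<oplus> X) \<le> Ls (G \<oplus> X)" if "H' |\<in>| lopts H" for H'
        \<comment> \<open>An option from \<open>GL\<close> is a move from \<open>G\<close> itself;
          one from \<open>BL\<close> is a move from \<open>B\<close>, and \<open>BG\<close> carries
          the bound over to \<open>G\<close>.\<close>
        using that moveK[of H' G] moveK[of H' B] BG by (auto simp: loptsG loptsB loptsH)
      show "Rs (H \<oplus> X') \<le> Ls (G \<oplus> X)" if "X' |\<in>| lopts X" for X'
        using moveX[OF that, of G] IHl[OF that] by simp
    qed
    ultimately show ?case using right by simp
  qed
  then show ?thesis
    by (simp add: game_equiv_def game_ge_def flip: H_def)
qed

end
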